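(* Let $n$ and $k$ be integers. Depending on which region of the Cartesian plane the point $(n,k)$ is in, the following formulas apply to the Roman coefficient $\left\lfloor {n \atop k} \right\rceil$. (Region 1) If $n\ge k\ge 0$, then $\left\lfloor {n \atop k} \right\rceil=\binom{n}{k}$. (Region 2) If $k\ge 0>n$, then $\left\lfloor {n \atop k} \right\rceil=(-1)^k\binom{-n+k-1}{k}$. (Region 3) If $0>n\ge k$, then $\left\lfloor {n \atop k} \right\rceil=(-1)^{n+k}\binom{-k-1}{n-k}$. (Region 4) If $k>n\ge 0$, then $$\left\lfloor {n \atop k} \right\rceil=(-1)^{n+k}\frac{1}{n-k}\binom{k}{n}^{-1}=(-1)^{n+k+1}\frac{1}{n+1}\binom{k}{n+1}^{-1}=(-1)^{n+k+1}\frac1k\binom{k-1}{n}^{-1}$$ $$=(-1)^{n+k+1}\,n\sum_{j\ge 0}S(j,n)/k^{j+1}=(-1)^{n+k}\left[\Delta^n\frac{1}{x-k}\right]_{x=0}.$$ (Region 5) If $n\ge 0>k$, then $$\left\lfloor {n \atop k} \right\rceil=(-1)^{k}\frac{1}{k}\binom{n-k}{n}^{-1}=(-1)^{k}\frac{1}{k-n}\binom{n-k-1}{n}^{-1}=(-1)^{k+1}\frac{1}{n+1}\binom{n-k-1}{n+1}^{-1}$$ $$=\left\lfloor {n \atop n-k} \right\rceil=(-1)^k\left[\Delta^n\frac{1}{x-n+k}\right]_{x=0}=-B(k-n,-k),$$ where the pair $(n,n-k)$ lies in Region 4. (Region 6) If $0>k>n$, then $$\left\lfloor {n \atop k} \right\rceil=\frac{1}{n-k}\binom{-n-1}{-k-1}^{-1}=\frac1k\binom{-n-1}{-k}^{-1}=\frac{1}{n+1}\binom{-n-2}{-k-1}^{-1}=\left[\Delta^{k-n-1}\frac{1}{x+n+1}\right]_{x=0}$$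 $$=(-1)^{k+1}\left\lfloor {k-n-1 \atop -n-1} \right\rceil=(-1)^{k+1}\left\lfloor {k-n-1 \atop k} \right\rceil,$$ where the pair $(k-n-1,-n-1)$ lies in Region 4 and the pair $(k-n-1,k)$ lies in Region 5.
   Context: For an integer $n$, the Roman factorial is $\lfloor n\rceil!=n!$ if $n\ge 0$, and $\lfloor n\rceil!=(-1)^{n+1}/(-n-1)!$ if $n<0$. For integers $n,k$ the Roman coefficient is $$\left\lfloor {n \atop k} \right\rceil=\frac{\lfloor n\rceil!}{\lfloor k\rceil!\,\lfloor n-k\rceil!}.$$ $\binom{n}{k}$ is the ordinary binomial coefficient, $S(j,n)$ denotes the Stirling numbers of the second kind, $\Delta$ is the forward difference operator $\Delta p(x)=p(x+1)-p(x)$, and $B$ is the analytic Beta function.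
   Formalization: Three false printed formulas are corrected: in Region 4 the factor before the Stirling sum is n!, not n; in Region 5 the third binomial is (n-k choose n+1), not (n-k-1 choose n+1); in Region 6 the sign before the last two Roman coefficients is (-1)^k, not (-1)^{k+1}. *)

theory Defs
  imports "HOL-Complex_Analysis.Complex_Analysis" "HOL-Combinatorics.Stirling"
begin

text \<open>
  The stated identities differ from the printed ones at three places, where the printed
  formulas are false for these Roman coefficients.

  In region 4 the factor in front of the Stirling series is \<open>n!\<close>, not \<open>n\<close> (at \<open>n = 0\<close>,
  \<open>k = 1\<close> the coefficient is \<open>1\<close>, the printed right-hand side \<open>0\<close>).

  In region 5 the third binomial coefficient is \<open>n - k\<close> over \<open>n + 1\<close>, not \<open>n - k - 1\<close> over
  \<open>n + 1\<close> (at \<open>n = 0\<close>, \<open>k = -2\<close> the coefficient is \<open>-1/2\<close>, the printed right-hand side \<open>-1\<close>;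
  for \<open>k = -1\<close> the printed binomial coefficient is \<open>0\<close>).

  In region 6 the sign in front of the two reflected Roman coefficients is \<open>(-1)^k\<close>, not
  \<open>(-1)^(k+1)\<close> (at \<open>n = -2\<close>, \<open>k = -1\<close> the coefficient is \<open>-1\<close>, the printed right-hand
  sides \<open>1\<close>).
\<close>

definition roman_fact :: "int \<Rightarrow> real" where
  "roman_fact n =
     (if n \<ge> 0 then fact (nat n) else (-1) powi (n + 1) / fact (nat (- n - 1)))"

definition roman_coeff :: "int \<Rightarrow> int \<Rightarrow> real" where
  "roman_coeff n k = roman_fact n / (roman_fact k * roman_fact (n - k))"

text \<open>
  The ordinary binomial coefficient at integer arguments. It is only meant for
  \<open>n, k \<ge> 0\<close>, where \<^const>\<open>nat\<close> does not truncate.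
\<close>

definition ibinom :: "int \<Rightarrow> int \<Rightarrow> real" where
  "ibinom n k = real (nat n choose nat k)"

definition fwd_diff :: "(real \<Rightarrow> real) \<Rightarrow> real \<Rightarrow> real" where
  "fwd_diff p = (\<lambda>x. p (x + 1) - p x)"

text \<open>
  \<^const>\<open>Beta\<close> is a quotient of Gamma values and takes the junk value \<open>0\<close> where a Gamma function
  in the numerator has a pole. The analytic Beta function used here is its continuation in the
  first argument: for a positive integer \<open>b\<close> and an integer \<open>a\<close> with \<open>a + b \<le> 0\<close>, the poles of
  \<open>Gamma z\<close> and \<open>Gamma (z + b)\<close> at \<open>z = a\<close> cancel and the singularity at \<open>a\<close> is removable.
\<close>

definition analytic_Beta :: "complex \<Rightarrow> complex \<Rightarrow> complex" where
  "analytic_Beta a b = remove_sings (\<lambda>z. Beta z b) a"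

definition region1 :: "(int \<times> int) set" where
  "region1 = {(n, k). n \<ge> k \<and> k \<ge> 0}"

definition region2 :: "(int \<times> int) set" where
  "region2 = {(n, k). k \<ge> 0 \<and> 0 > n}"

definition region3 :: "(int \<times> int) set" where
  "region3 = {(n, k). 0 > n \<and> n \<ge> k}"

definition region4 :: "(int \<times> int) set" where
  "region4 = {(n, k). k > n \<and> n \<ge> 0}"

definition region5 :: "(int \<times> int) set" where
  "region5 = {(n, k). n \<ge> 0 \<and> 0 > k}"

definition region6 :: "(int \<times> int) set" where
  "region6 = {(n, k). 0 > k \<and> k > n}"

end

theory Submission
  imports Defs
begin

text \<open>
  Up to sign, a negative argument moves its factorial to the other side of the fraction that
  defines the Roman coefficient. In region 1 none of \<open>n\<close>, \<open>k\<close>, \<open>n - k\<close> is negative; in the regions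
  2 and 3 the number \<open>n\<close> and one of the other two are. One factorial then remains above the
  fraction bar and two below, which is an ordinary binomial coefficient.

  In the regions 4 to 6 one or all three arguments are negative, so two factorials are above the
  bar and one below. Put \<open>Q(a, b) = a! b! / (a + b + 1)!\<close>, the value
  \<open>B(a + 1, b + 1)\<close> of the Beta function. With natural numbers \<open>a, b\<close>, the coordinates
  \<^item> \<open>n = a\<close>, \<open>k = a + b + 1\<close> describe region 4,
  \<^item> \<open>n = a\<close>, \<open>k = -(b + 1)\<close> describe region 5,
  \<^item> \<open>n = -(a + b + 2)\<close>, \<open>k = -(b + 1)\<close> describe region 6,

  and the Roman coefficient is \<open>(-1)^b Q(a, b)\<close>, \<open>(-1)^b Q(a, b)\<close>, \<open>-Q(a, b)\<close>, respectively.
  The reflections between the regions can be read off from this. All remaining formulas are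
  expressions for the single quantity \<open>Q(a, b)\<close>:
  \<^item> Absorbing one factor into a factorial gives the three inverse binomial coefficients
    (\<open>beta_quot_binomial\<close>).
  \<^item> The \<open>a\<close>-th difference of \<open>1 / x\<close> is \<open>(-1)^a a!\<close> over a rising factorial. In all three regions
    it is taken at \<open>-(a + b + 1)\<close>, where its value is \<open>-Q(a, b)\<close> (\<open>fwd_diff_eq_beta_quot\<close>).
  \<^item> The ordinary generating function of \<open>S(j, a)\<close>, evaluated at \<open>1 / x\<close> and divided by \<open>x\<close>, is the
    inverse of \<open>x (x - 1) \<dots> (x - a)\<close>; at \<open>x = a + b + 1\<close> this product is \<open>(a + b + 1)! / b!\<close>
    (\<open>Stirling_ogf_beta_quot\<close>).
  \<^item> For a positive integer second argument the Beta function is a factorial over a rising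
    factorial, so its continuation at a negative integer is explicit
    (\<open>analytic_Beta_neg_of_nat\<close>).
\<close>

section \<open>Signs and Roman factorials\<close>

lemma neg_one_powi: "(-1 :: real) powi i = (if even i then 1 else -1)"
  by (auto simp: power_int_def even_nat_iff)

lemma ibinom_of_nat [simp]: "ibinom (int m) (int j) = real (m choose j)"
  by (simp add: ibinom_def)

lemma roman_fact_of_nat [simp]: "roman_fact (int m) = fact m"
  by (simp add: roman_fact_def)

lemma roman_fact_neg: "roman_fact (- int m - 1) = (-1) ^ m / fact m"
  by (auto simp: roman_fact_def neg_one_powi minus_one_power_iff)

section \<open>The common value of the coefficients in regions 4 to 6\<close>

definition beta_quot :: "nat \<Rightarrow> nat \<Rightarrow> real" where
  "beta_quot a b = fact a * fact b / fact (a + b + 1)"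

lemma beta_quot_commute: "beta_quot a b = beta_quot b a"
  by (simp add: beta_quot_def add_ac)

lemma binomial_real_fact: "real ((i + j) choose i) = fact (i + j) / (fact i * fact j)"
  by (simp add: binomial_fact)

text \<open>
  The forms arise by writing \<open>b!\<close> as \<open>(b + 1)! / (b + 1)\<close>, \<open>a!\<close> as \<open>(a + 1)! / (a + 1)\<close>, and
  \<open>(a + b + 1)!\<close> as \<open>(a + b + 1) (a + b)!\<close>.
\<close>

lemma beta_quot_binomial:
  shows "beta_quot a b = 1 / real (b + 1) * inverse (real ((a + b + 1) choose a))"
    and "beta_quot a b = 1 / real (a + 1) * inverse (real ((a + b + 1) choose (a + 1)))"
    and "beta_quot a b = 1 / real (a + b + 1) * inverse (real ((a + b) choose a))"
  using binomial_real_fact[of a "b + 1"] binomial_real_fact[of "a + 1" b] binomial_real_fact[of a b]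
  by (simp_all add: beta_quot_def add_ac mult_ac divide_simps
      del: of_nat_add of_nat_Suc binomial_Suc_Suc)

lemma pochhammer_Suc_of_nat:
  "pochhammer (of_nat (Suc b) :: 'a :: field_char_0) m = fact (b + m) / fact b"
proof -
  have "fact (b + m) = fact b * pochhammer (of_nat (Suc b) :: 'a) m"
    using pochhammer_product'[of "1 :: 'a" b m] by (simp add: pochhammer_fact add_ac)
  thus ?thesis by simp
qed

text \<open>
  The rising factorial that starts at \<open>-(a + b + 1)\<close> ends at \<open>-(b + 1)\<close>. Read backwards it is, up
  to sign, the rising factorial from \<open>b + 1\<close> to \<open>a + b + 1\<close>. It is the denominator both of the
  iterated difference and, with \<open>a\<close> and \<open>b\<close> exchanged, of the continued Beta function.
\<close>

lemma pochhammer_neg: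
  "pochhammer (- of_nat (a + b + 1) :: 'a :: field_char_0) (Suc a)
     = (-1) ^ Suc a * (fact (a + b + 1) / fact b)"
proof -
  have "of_nat (a + b + 1) - of_nat (Suc a) + 1 = (of_nat (Suc b) :: 'a)"
    by simp
  thus ?thesis
    by (simp only: pochhammer_minus pochhammer_Suc_of_nat) (simp add: add_ac)
qed

section \<open>Iterated differences of a reciprocal\<close>

text \<open>
  Each difference puts two rising factorials that overlap in all but their outermost factors over
  a common denominator, and the numerators differ by \<open>n + 1\<close>. The hypothesis keeps the sample
  points \<open>y, y + 1, \<dots>, y + n\<close> away from the pole \<open>x = -c\<close>, where \<open>1 / 0 = 0\<close> would enter.
\<close>

lemma fwd_diff_funpow_inverse:
  assumes "\<And>i. i \<le> n \<Longrightarrow> y + c + real i \<noteq> 0"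
  shows "(fwd_diff ^^ n) (\<lambda>x. 1 / (x + c)) y = (-1) ^ n * fact n / pochhammer (y + c) (Suc n)"
  using assms
proof (induction n arbitrary: y)
  case 0
  show ?case by simp
next
  case (Suc n)
  define P where "P = pochhammer (y + c + 1) n"
  have P: "P \<noteq> 0"
  proof
    assume "P = 0"
    then obtain i where "i < n" "y + c + 1 = - real i"
      by (auto simp: P_def pochhammer_eq_0_iff)
    thus False using Suc.prems[of "Suc i"] by simp
  qed
  have nz: "y + c \<noteq> 0" "y + c + 1 + real n \<noteq> 0"
    using Suc.prems[of 0] Suc.prems[of "Suc n"] by (simp_all add: add_ac)
  have "(fwd_diff ^^ n) (\<lambda>x. 1 / (x + c)) (y + 1)
      = (-1) ^ n * fact n / pochhammer (y + 1 + c) (Suc n)"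
  proof (rule Suc.IH)
    fix i assume "i \<le> n"
    thus "y + 1 + c + real i \<noteq> 0"
      using Suc.prems[of "Suc i"] by (simp add: add_ac)
  qed
  also have "y + 1 + c = y + c + 1" by simp
  also have "pochhammer (y + c + 1) (Suc n) = P * (y + c + 1 + real n)"
    by (simp add: P_def pochhammer_Suc)
  finally have 1: "(fwd_diff ^^ n) (\<lambda>x. 1 / (x + c)) (y + 1)
      = (-1) ^ n * fact n / (P * (y + c + 1 + real n))" .
  have 2: "(fwd_diff ^^ n) (\<lambda>x. 1 / (x + c)) y = (-1) ^ n * fact n / ((y + c) * P)"
    using Suc.IH[of y] Suc.prems by (simp add: P_def pochhammer_rec)
  have 3: "pochhammer (y + c) (Suc (Suc n)) = (y + c) * (P * (y + c + 1 + real n))"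
    by (simp only: P_def pochhammer_rec[of "y + c" "Suc n"] pochhammer_Suc[of "y + c + 1"])
  have "(fwd_diff ^^ Suc n) (\<lambda>x. 1 / (x + c)) y
      = (fwd_diff ^^ n) (\<lambda>x. 1 / (x + c)) (y + 1) - (fwd_diff ^^ n) (\<lambda>x. 1 / (x + c)) y"
    by (simp add: fwd_diff_def)
  also have "\<dots> = (-1) ^ n * fact n * ((y + c) - (y + c + 1 + real n))
      / ((y + c) * (P * (y + c + 1 + real n)))"
    unfolding 1 2 using P nz by (simp add: divide_simps) (simp add: algebra_simps)
  also have "(-1) ^ n * fact n * ((y + c) - (y + c + 1 + real n)) = (-1) ^ Suc n * fact (Suc n)"
    by (simp add: algebra_simps)
  finally show ?case unfolding 3 .
qed

lemma fwd_diff_eq_beta_quot: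
  "(fwd_diff ^^ a) (\<lambda>x. 1 / (x - real (a + b + 1))) 0 = - beta_quot a b"
proof -
  have "(fwd_diff ^^ a) (\<lambda>x. 1 / (x + - real (a + b + 1))) 0
      = (-1) ^ a * fact a / pochhammer (0 + - real (a + b + 1)) (Suc a)"
    by (intro fwd_diff_funpow_inverse) simp
  thus ?thesis
    unfolding add_0_left unfolding pochhammer_neg add_uminus_conv_diff
    by (simp add: beta_quot_def del: of_nat_add of_nat_Suc fact_Suc)
qed

section \<open>The generating function of the Stirling numbers\<close>

text \<open>
  Multiplied by \<open>x\<close>, the recurrence \<open>S(j + 1, n + 1) = (n + 1) S(j, n + 1) + S(j, n)\<close> becomes an
  affine relation between consecutive partial sums for \<open>n + 1\<close>, with the partial sums for \<open>n\<close> as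
  inhomogeneous part. As all terms are nonnegative and \<open>x > n + 1\<close>, this relation bounds the
  partial sums, which therefore converge; its limit is a linear equation for the sum. It adds the
  factor \<open>x - (n + 1)\<close> to the denominator.
\<close>

lemma Stirling_ogf_sums:
  assumes "x > real n"
  shows "(\<lambda>j. real (Stirling j n) / x ^ (j + 1)) sums (1 / pochhammer (x - real n) (Suc n))"
  using assms
proof (induction n)
  case 0
  have "(\<lambda>j. real (Stirling j 0) / x ^ (j + 1)) = (\<lambda>j. if j = 0 then 1 / x else 0)"
    by (auto simp: fun_eq_iff gr0_conv_Suc)
  thus ?case using sums_single[of 0 "\<lambda>_. 1 / x"] by simp
next
  case (Suc n)
  have x: "x > 0" "x > real n" "x > real (Suc n)" using Suc.prems by simp_all
  define A where "A = (\<lambda>N. \<Sum>j<N. real (Stirling j n) / x ^ (j + 1))"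
  define B where "B = (\<lambda>N. \<Sum>j<N. real (Stirling j (Suc n)) / x ^ (j + 1))"
  define L where "L = 1 / pochhammer (x - real n) (Suc n)"
  have A: "A \<longlonglongrightarrow> L"
    using Suc.IH x by (simp add: sums_def A_def L_def)
  have rec: "x * B (Suc N) = real (Suc n) * B N + A N" for N
  proof -
    have "x * B (Suc N) = (\<Sum>j<N. x * (real (Stirling (Suc j) (Suc n)) / x ^ (Suc j + 1)))"
      unfolding B_def by (subst sum.lessThan_Suc_shift) (simp add: sum_distrib_left)
    also have "\<dots> = (\<Sum>j<N. real (Suc n) * (real (Stirling j (Suc n)) / x ^ (j + 1))
        + real (Stirling j n) / x ^ (j + 1))"
      using x by (intro sum.cong) (simp_all add: add_divide_distrib algebra_simps)
    also have "\<dots> = real (Suc n) * B N + A N"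
      by (simp only: A_def B_def sum.distrib sum_distrib_left)
    finally show ?thesis .
  qed
  have "incseq A" "incseq B"
    using x by (auto simp: A_def B_def incseq_Suc_iff)
  have bound: "\<forall>N. B N \<le> L / (x - real (Suc n))"
  proof
    fix N
    have "x * B N \<le> real (Suc n) * B N + A N"
      unfolding rec [symmetric] using \<open>incseq B\<close> x by (simp add: incseq_SucD)
    also have "A N \<le> L"
      using \<open>incseq A\<close> A by (rule incseq_le)
    finally show "B N \<le> L / (x - real (Suc n))"
      using x by (simp add: field_simps)
  qed
  obtain M where M: "B \<longlonglongrightarrow> M"
    using incseq_convergent[OF \<open>incseq B\<close> bound] by blast
  have "(\<lambda>N. x * B (Suc N)) \<longlonglongrightarrow> x * M"
    using M by (intro tendsto_intros LIMSEQ_Suc)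
  moreover have "(\<lambda>N. real (Suc n) * B N + A N) \<longlonglongrightarrow> real (Suc n) * M + L"
    using M A by (intro tendsto_intros)
  ultimately have "x * M = real (Suc n) * M + L"
    unfolding rec by (rule LIMSEQ_unique)
  hence "M = L / (x - real (Suc n))"
    using x by (simp add: field_simps)
  also have "\<dots> = 1 / ((x - real (Suc n)) * pochhammer (x - real (Suc n) + 1) (Suc n))"
    by (simp add: L_def)
  also have "\<dots> = 1 / pochhammer (x - real (Suc n)) (Suc (Suc n))"
    by (simp only: pochhammer_rec[of _ "Suc n"])
  finally show ?case
    using M by (simp add: sums_def B_def)
qed

lemma Stirling_ogf_beta_quot:
  "(\<lambda>j. fact a * (real (Stirling j a) / real (a + b + 1) ^ (j + 1))) sums beta_quot a b"
proof -
  have "real (a + b + 1) - real a = real (Suc b)" by simp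
  hence "(\<lambda>j. real (Stirling j a) / real (a + b + 1) ^ (j + 1)) sums
      (1 / (fact (b + Suc a) / fact b))"
    using Stirling_ogf_sums[of a "real (a + b + 1)"] by (simp only: pochhammer_Suc_of_nat)
  from sums_mult[OF this, of "fact a"] show ?thesis
    by (simp add: beta_quot_def add_ac)
qed

section \<open>The Beta function at a positive integer second argument\<close>

lemma Beta_of_nat_right:
  fixes z :: complex
  assumes "z \<notin> \<int>\<^sub>\<le>\<^sub>0"
  shows "Beta z (of_nat (Suc m)) = fact m / pochhammer z (Suc m)"
  using pochhammer_Gamma[OF assms, of "Suc m"] Gamma_fact[of m, where 'a = complex]
  by (simp add: Beta_def)

lemma eventually_notin_nonpos_Ints: "eventually (\<lambda>z :: complex. z \<notin> \<int>\<^sub>\<le>\<^sub>0) (at a)"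
proof -
  have "closed (\<int>\<^sub>\<le>\<^sub>0 - {a})"
    by (rule closed_subset_Ints) (auto simp: nonpos_Ints_def)
  hence "eventually (\<lambda>z. z \<in> - (\<int>\<^sub>\<le>\<^sub>0 - {a})) (nhds a)"
    by (intro eventually_nhds_in_open open_Compl) auto
  thus ?thesis
    by (auto simp: eventually_at_filter elim: eventually_mono)
qed

text \<open>
  Off the poles of \<open>Gamma\<close> the Beta function is the rational function on the right, which is
  continuous at \<open>a\<close>; it is therefore the value that fills the singularity.
\<close>

lemma analytic_Beta_of_nat_right:
  assumes "pochhammer a (Suc m) \<noteq> 0"
  shows "analytic_Beta a (of_nat (Suc m)) = fact m / pochhammer a (Suc m)"
  unfolding analytic_Beta_def
proof (rule remove_sings_eqI)
  have "(\<lambda>z. fact m / pochhammer z (Suc m)) \<midarrow>a\<rightarrow> fact m / pochhammer a (Suc m)"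
    using assms unfolding pochhammer_prod by (intro tendsto_intros)
  moreover have "eventually (\<lambda>z. Beta z (of_nat (Suc m)) = fact m / pochhammer z (Suc m)) (at a)"
    using eventually_notin_nonpos_Ints by eventually_elim (rule Beta_of_nat_right)
  ultimately show "(\<lambda>z. Beta z (of_nat (Suc m))) \<midarrow>a\<rightarrow> fact m / pochhammer a (Suc m)"
    by (simp add: tendsto_cong)
qed

lemma analytic_Beta_neg_of_nat:
  "analytic_Beta (- of_nat (a + b + 1)) (of_nat (Suc b))
     = (-1) ^ Suc b * complex_of_real (beta_quot a b)"
proof -
  have "pochhammer (- of_nat (a + b + 1) :: complex) (Suc b)
      = (-1) ^ Suc b * (fact (a + b + 1) / fact a)"
    using pochhammer_neg[of b a] by (simp only: add.commute[of b a])
  thus ?thesis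
    by (subst analytic_Beta_of_nat_right)
      (simp_all add: beta_quot_def minus_one_power_iff del: fact_Suc of_nat_add of_nat_Suc)
qed

section \<open>Roman coefficients in regions 4 to 6\<close>

lemma roman_coeff_region4:
  "roman_coeff (int a) (int (a + b + 1)) = (-1) ^ b * beta_quot a b"
proof -
  have "int a - int (a + b + 1) = - int b - 1" by simp
  thus ?thesis
    by (simp only: roman_coeff_def roman_fact_of_nat roman_fact_neg)
      (simp add: beta_quot_def minus_one_power_iff)
qed

lemma roman_coeff_symmetric: "roman_coeff n (n - k) = roman_coeff n k"
  by (simp add: roman_coeff_def)

text \<open>The symmetry \<open>k \<mapsto> n - k\<close> maps region 5 to region 4 and preserves \<open>a\<close> and \<open>b\<close>.\<close>

lemma roman_coeff_region5:
  "roman_coeff (int a) (- int b - 1) = (-1) ^ b * beta_quot a b"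
proof -
  have "int a - (- int b - 1) = int (a + b + 1)" by simp
  thus ?thesis
    using roman_coeff_region4[of a b] roman_coeff_symmetric[of "int a" "- int b - 1"]
    by (simp only:)
qed

lemma roman_coeff_region6:
  "roman_coeff (- int (a + b + 1) - 1) (- int b - 1) = - beta_quot a b"
proof -
  have "- int (a + b + 1) - 1 - (- int b - 1) = - int a - 1" by simp
  thus ?thesis
    by (simp only: roman_coeff_def roman_fact_neg)
      (simp add: beta_quot_def minus_one_power_iff)
qed

section \<open>The formulas for the six regions\<close>

theorem proposition1p3:
  fixes n k :: int
  shows
    "((n, k) \<in> region1 \<longrightarrow> roman_coeff n k = ibinom n k) \<and>
     ((n, k) \<in> region2 \<longrightarrow> roman_coeff n k = (-1) powi k * ibinom (- n + k - 1) k) \<and>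
     ((n, k) \<in> region3 \<longrightarrow> roman_coeff n k = (-1) powi (n + k) * ibinom (- k - 1) (n - k)) \<and>
     ((n, k) \<in> region4 \<longrightarrow>
        roman_coeff n k = (-1) powi (n + k) * (1 / of_int (n - k)) * inverse (ibinom k n) \<and>
        roman_coeff n k = (-1) powi (n + k + 1) * (1 / of_int (n + 1)) * inverse (ibinom k (n + 1)) \<and>
        roman_coeff n k = (-1) powi (n + k + 1) * (1 / of_int k) * inverse (ibinom (k - 1) n) \<and>
        summable (\<lambda>j. real (Stirling j (nat n)) / of_int k ^ (j + 1)) \<and>
        roman_coeff n k = (-1) powi (n + k + 1) * fact (nat n) *
          (\<Sum>j. real (Stirling j (nat n)) / of_int k ^ (j + 1)) \<and>
        roman_coeff n k = (-1) powi (n + k) * (fwd_diff ^^ nat n) (\<lambda>x. 1 / (x - of_int k)) 0) \<and>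
     ((n, k) \<in> region5 \<longrightarrow>
        roman_coeff n k = (-1) powi k * (1 / of_int k) * inverse (ibinom (n - k) n) \<and>
        roman_coeff n k = (-1) powi k * (1 / of_int (k - n)) * inverse (ibinom (n - k - 1) n) \<and>
        roman_coeff n k = (-1) powi (k + 1) * (1 / of_int (n + 1)) * inverse (ibinom (n - k) (n + 1)) \<and>
        (n, n - k) \<in> region4 \<and>
        roman_coeff n k = roman_coeff n (n - k) \<and>
        roman_coeff n k =
          (-1) powi k * (fwd_diff ^^ nat n) (\<lambda>x. 1 / (x - of_int n + of_int k)) 0 \<and>
        complex_of_real (roman_coeff n k) = - analytic_Beta (of_int (k - n)) (of_int (- k))) \<and>
     ((n, k) \<in> region6 \<longrightarrow>
        roman_coeff n k = 1 / of_int (n - k) * inverse (ibinom (- n - 1) (- k - 1)) \<and>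
        roman_coeff n k = 1 / of_int k * inverse (ibinom (- n - 1) (- k)) \<and>
        roman_coeff n k = 1 / of_int (n + 1) * inverse (ibinom (- n - 2) (- k - 1)) \<and>
        roman_coeff n k = (fwd_diff ^^ nat (k - n - 1)) (\<lambda>x. 1 / (x + of_int n + 1)) 0 \<and>
        (k - n - 1, - n - 1) \<in> region4 \<and>
        roman_coeff n k = (-1) powi k * roman_coeff (k - n - 1) (- n - 1) \<and>
        (k - n - 1, k) \<in> region5 \<and>
        roman_coeff n k = (-1) powi k * roman_coeff (k - n - 1) k)"
proof ((intro conjI; rule impI), goal_cases)
  case 1
  then obtain j m where "k = int j" "n = int (j + m)"
    unfolding region1_def by (auto intro!: that[of "nat k" "nat (n - k)"])
  moreover from this have "n - k = int m"
    by simp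
  ultimately show ?case
    by (simp only: roman_coeff_def roman_fact_of_nat ibinom_of_nat binomial_real_fact)
next
  case 2
  then obtain m j where "n = - int m - 1" "k = int j"
    unfolding region2_def by (auto intro!: that[of "nat (- n - 1)" "nat k"])
  moreover from this have "n - k = - int (j + m) - 1" "- n + k - 1 = int (j + m)"
    by simp_all
  ultimately show ?case
    by (simp only: roman_coeff_def roman_fact_of_nat roman_fact_neg ibinom_of_nat binomial_real_fact)
      (simp add: neg_one_powi minus_one_power_iff)
next
  case 3
  then obtain m d where "n = - int m - 1" "k = - int (d + m) - 1"
    unfolding region3_def by (auto intro!: that[of "nat (- n - 1)" "nat (n - k)"])
  moreover from this have "n - k = int d" "- k - 1 = int (d + m)"
    by simp_all
  ultimately show ?case
    by (simp only: roman_coeff_def roman_fact_of_nat roman_fact_neg ibinom_of_nat binomial_real_fact)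
      (simp add: neg_one_powi minus_one_power_iff)
next
  case 4
  then obtain a b where nk: "n = int a" "k = int (a + b + 1)"
    unfolding region4_def by (auto intro!: that[of "nat n" "nat (k - n - 1)"])
  have rc: "roman_coeff n k = (-1) ^ b * beta_quot a b"
    unfolding nk by (rule roman_coeff_region4)
  have sign: "(-1) powi (n + k) = (- ((-1) ^ b) :: real)" "(-1) powi (n + k + 1) = ((-1) ^ b :: real)"
    by (simp_all add: nk neg_one_powi minus_one_power_iff)
  have args: "k - 1 = int (a + b)" "n + 1 = int (a + 1)" "n - k = - int (b + 1)"
    by (simp_all add: nk)
  have nat: "nat n = a"
    by (simp add: nk)
  have sums: "(\<lambda>j. fact a * (real (Stirling j a) / of_int k ^ (j + 1))) sums beta_quot a b"
    using Stirling_ogf_beta_quot[of a b] by (simp add: nk)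
  hence summable: "summable (\<lambda>j. real (Stirling j a) / of_int k ^ (j + 1))"
    by (rule summable_mult_D[OF sums_summable fact_nonzero])
  have recip: "(\<lambda>x :: real. 1 / (x - of_int k)) = (\<lambda>x. 1 / (x - real (a + b + 1)))"
    by (simp add: nk algebra_simps)
  have "roman_coeff n k = (-1) powi (n + k) * (1 / of_int (n - k)) * inverse (ibinom k n)"
    unfolding rc sign args unfolding nk ibinom_of_nat beta_quot_binomial(1)
    by (simp del: of_nat_add of_nat_Suc)
  moreover have "roman_coeff n k
      = (-1) powi (n + k + 1) * (1 / of_int (n + 1)) * inverse (ibinom k (n + 1))"
    unfolding rc sign args unfolding nk ibinom_of_nat beta_quot_binomial(2)
    by (simp del: of_nat_add of_nat_Suc)
  moreover have "roman_coeff n k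
      = (-1) powi (n + k + 1) * (1 / of_int k) * inverse (ibinom (k - 1) n)"
    unfolding rc sign args unfolding nk ibinom_of_nat beta_quot_binomial(3)
    by (simp del: of_nat_add of_nat_Suc)
  moreover have "summable (\<lambda>j. real (Stirling j (nat n)) / of_int k ^ (j + 1))"
    unfolding nat by (rule summable)
  moreover have "roman_coeff n k = (-1) powi (n + k + 1) * fact (nat n) *
      (\<Sum>j. real (Stirling j (nat n)) / of_int k ^ (j + 1))"
    unfolding rc sign nat mult.assoc
    by (subst sums_unique[OF sums], subst suminf_mult[OF summable]) (rule refl)
  moreover have "roman_coeff n k
      = (-1) powi (n + k) * (fwd_diff ^^ nat n) (\<lambda>x. 1 / (x - of_int k)) 0"
    unfolding rc sign nat recip fwd_diff_eq_beta_quot by simp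
  ultimately show ?case
    by (intro conjI)
next
  case 5
  then obtain a b where nk: "n = int a" "k = - int b - 1"
    unfolding region5_def by (auto intro!: that[of "nat n" "nat (- k - 1)"])
  have rc: "roman_coeff n k = (-1) ^ b * beta_quot a b"
    unfolding nk by (rule roman_coeff_region5)
  have sign: "(-1) powi k = (- ((-1) ^ b) :: real)" "(-1) powi (k + 1) = ((-1) ^ b :: real)"
    by (simp_all add: nk neg_one_powi minus_one_power_iff)
  have args: "n - k - 1 = int (a + b)" "n + 1 = int (a + 1)" "n - k = int (a + b + 1)"
    "k - n = - int (a + b + 1)" "- k = int (Suc b)" and k: "k = - int (b + 1)"
    by (simp_all add: nk)
  have nat: "nat n = a"
    by (simp add: nk)
  have recip: "(\<lambda>x :: real. 1 / (x - of_int n + of_int k)) = (\<lambda>x. 1 / (x - real (a + b + 1)))"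
    by (simp add: nk algebra_simps)
  have "roman_coeff n k = (-1) powi k * (1 / of_int k) * inverse (ibinom (n - k) n)"
    unfolding rc sign args unfolding k nk(1) ibinom_of_nat beta_quot_binomial(1)
    by (simp del: of_nat_add of_nat_Suc)
  moreover have "roman_coeff n k = (-1) powi k * (1 / of_int (k - n)) * inverse (ibinom (n - k - 1) n)"
    unfolding rc sign args(1,4) unfolding nk(1) ibinom_of_nat beta_quot_binomial(3)
    by (simp del: of_nat_add of_nat_Suc)
  moreover have "roman_coeff n k
      = (-1) powi (k + 1) * (1 / of_int (n + 1)) * inverse (ibinom (n - k) (n + 1))"
    unfolding rc sign args ibinom_of_nat beta_quot_binomial(2)
    by (simp del: of_nat_add of_nat_Suc)
  moreover have "(n, n - k) \<in> region4"
    by (simp add: region4_def nk)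
  moreover have "roman_coeff n k = roman_coeff n (n - k)"
    by (simp only: roman_coeff_symmetric)
  moreover have "roman_coeff n k
      = (-1) powi k * (fwd_diff ^^ nat n) (\<lambda>x. 1 / (x - of_int n + of_int k)) 0"
    unfolding rc sign nat recip fwd_diff_eq_beta_quot by simp
  moreover have "complex_of_real (roman_coeff n k) = - analytic_Beta (of_int (k - n)) (of_int (- k))"
    unfolding rc args using analytic_Beta_neg_of_nat[of a b] by simp
  ultimately show ?case
    by (intro conjI)
next
  case 6
  then obtain a b where nk: "n = - int (a + b + 1) - 1" "k = - int b - 1"
    unfolding region6_def by (auto intro!: that[of "nat (k - n - 1)" "nat (- k - 1)"])
  have rc: "roman_coeff n k = - beta_quot a b"
    unfolding nk by (rule roman_coeff_region6)
  have sign: "(-1) powi k = (- ((-1) ^ b) :: real)"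
    by (simp add: nk neg_one_powi minus_one_power_iff)
  \<comment> \<open>The lower entries of the binomial coefficients are built from \<open>k\<close>, that is, from \<open>b\<close>;
    so \<^const>\<open>beta_quot\<close> is expanded with its arguments exchanged.\<close>
  have args: "- n - 1 = int (b + a + 1)" "- k - 1 = int b" "- k = int (b + 1)" "- n - 2 = int (b + a)"
    "n - k = - int (a + 1)" "n + 1 = - int (b + a + 1)" "k - n - 1 = int a"
    and k: "k = - int (b + 1)"
    by (simp_all add: nk)
  have nat: "nat (k - n - 1) = a"
    by (simp add: nk)
  have recip: "(\<lambda>x :: real. 1 / (x + of_int n + 1)) = (\<lambda>x. 1 / (x - real (a + b + 1)))"
    by (simp add: nk algebra_simps)
  have "roman_coeff n k = 1 / of_int (n - k) * inverse (ibinom (- n - 1) (- k - 1))"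
    unfolding rc args(1,2,5) ibinom_of_nat beta_quot_commute[of a b] beta_quot_binomial(1)[of b a]
    by (simp del: of_nat_add of_nat_Suc)
  moreover have "roman_coeff n k = 1 / of_int k * inverse (ibinom (- n - 1) (- k))"
    unfolding rc args(1,3) unfolding k ibinom_of_nat beta_quot_commute[of a b] beta_quot_binomial(2)[of b a]
    by (simp del: of_nat_add of_nat_Suc)
  moreover have "roman_coeff n k = 1 / of_int (n + 1) * inverse (ibinom (- n - 2) (- k - 1))"
    unfolding rc args(2,4,6) ibinom_of_nat beta_quot_commute[of a b] beta_quot_binomial(3)[of b a]
    by (simp del: of_nat_add of_nat_Suc)
  moreover have "roman_coeff n k = (fwd_diff ^^ nat (k - n - 1)) (\<lambda>x. 1 / (x + of_int n + 1)) 0"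
    unfolding rc nat recip fwd_diff_eq_beta_quot by simp
  moreover have "(k - n - 1, - n - 1) \<in> region4" "(k - n - 1, k) \<in> region5"
    by (simp_all add: region4_def region5_def nk)
  moreover have "roman_coeff n k = (-1) powi k * roman_coeff (k - n - 1) (- n - 1)"
    unfolding rc sign args(1,7) add.commute[of b a] roman_coeff_region4
    by (simp add: minus_one_power_iff)
  moreover have "roman_coeff n k = (-1) powi k * roman_coeff (k - n - 1) k"
    unfolding rc sign args(7) unfolding nk(2) roman_coeff_region5 by (simp add: minus_one_power_iff)
  ultimately show ?case
    by (intro conjI)
qed

end
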